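(* Define $$T_1:=(s_2s_{10}s_{10}s_1)^4,\qquad T_2:=s_1T_1s_1,\qquad T_3:=s_5T_1s_5.$$ Then $T_1,T_2,T_3$ act on the parameters $(\alpha_0,\alpha_1,\dots,\alpha_5,\eta)$ as the translations \begin{align*} T_1(\alpha_0,\alpha_1,\ldots,\alpha_5,\eta)&=(\alpha_0,\alpha_1,\ldots,\alpha_5,\eta)+(0,-1,1,0,-1,1,0),\\ T_2(\alpha_0,\alpha_1,\ldots,\alpha_5,\eta)&=(\alpha_0,\alpha_1,\ldots,\alpha_5,\eta)+(-1,1,0,0,-1,1,1),\\ T_3(\alpha_0,\alpha_1,\ldots,\alpha_5,\eta)&=(\alpha_0,\alpha_1,\ldots,\alpha_5,\eta)+(1,-1,1,0,0,-1,-1). \end{align*}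
   Context: The complex parameters $\alpha_0,\dots,\alpha_5,\eta$ satisfy $\alpha_0+\alpha_1+\alpha_2+\alpha_3+\alpha_4+\alpha_5=1$. With the notation $( * ):=(q_1,p_1,q_2,p_2,t;\alpha_0,\alpha_1,\ldots,\alpha_5,\eta)$, the transformations are \begin{align*} s_1:( * )&\to\left(q_1+\tfrac{\alpha_1}{p_1},p_1,q_2,p_2,t;\alpha_0+\alpha_1,-\alpha_1,\alpha_2+\alpha_1,\alpha_3,\alpha_4,\alpha_5,\eta-\alpha_1\right),\\ s_2:( * )&\to\left(q_1,p_1-\tfrac{\alpha_2}{q_1-t},q_2,p_2,t;\alpha_0,\alpha_1+\alpha_2,-\alpha_2,\alpha_3+\alpha_2,\alpha_4,\alpha_5,\eta+\alpha_2\right),\\ s_5:( * )&\to\left(q_1,p_1,q_2+\tfrac{\alpha_5}{p_2},p_2,t;\alpha_0+\alpha_5,\alpha_1,\alpha_2,\alpha_3,\alpha_4+\alpha_5,-\alpha_5,\eta-\alpha_5\right),\\ s_{10}:( * )&\to\left(\tfrac{t}{q_2},-\tfrac{(p_2q_2+p_1q_1+\eta)q_2}{t},\tfrac{q_1}{q_2},p_1q_2,t;\alpha_2,\alpha_3,\alpha_4,\alpha_5,\alpha_0,\alpha_1,\eta\right). \end{align*} Each $s_i$ is regarded as the substitution automorphism of the field of rational functions in the variables and parameters sending each entry of $( * )$ to the corresponding entry on the right (e.g. $s_1(\alpha_0)=\alpha_0+\alpha_1$, $s_{10}(\alpha_0)=\alpha_2$), and products are compositions of automorphisms: $(st)(f)=s(t(f))$.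 An operator applied to a tuple of parameters is applied entrywise. *)

theory Defs
  imports
    Complex_Main
    "HOL-Library.Poly_Mapping"
    "HOL-Computational_Algebra.Fraction_Field"
begin

section \<open>The field of rational functions\<close>

text \<open>
  The parameters are subject to the relation that \<open>\<alpha>\<^sub>0 + \<dots> + \<alpha>\<^sub>5 = 1\<close>, so the field in question is
  the function field of that hyperplane (times the affine space of the other entries).  It is
  purely transcendental over the complex numbers: \<open>\<alpha>\<^sub>0\<close> is not one of the eleven independent
  variables but is the element \<open>1 - (\<alpha>\<^sub>1 + \<dots> + \<alpha>\<^sub>5)\<close>.
\<close>

datatype vname = Vq1 | Vp1 | Vq2 | Vp2 | Vt | V\<alpha>1 | V\<alpha>2 | V\<alpha>3 | V\<alpha>4 | V\<alpha>5 | V\<eta>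

text \<open>
  Some linear order on the variables (its choice is irrelevant) is required by the library's
  proof that polynomials form an integral domain.
\<close>

primrec vindex :: "vname \<Rightarrow> nat" where
  "vindex Vq1 = 0" | "vindex Vp1 = 1" | "vindex Vq2 = 2" | "vindex Vp2 = 3" | "vindex Vt = 4"
| "vindex V\<alpha>1 = 5" | "vindex V\<alpha>2 = 6" | "vindex V\<alpha>3 = 7" | "vindex V\<alpha>4 = 8" | "vindex V\<alpha>5 = 9"
| "vindex V\<eta> = 10"

lemma vindex_inj: "vindex x = vindex y \<Longrightarrow> x = y"
  by (cases x; cases y) auto

instantiation vname :: linorder
begin
definition less_eq_vname where "x \<le> y \<longleftrightarrow> vindex x \<le> vindex y"
definition less_vname where "x < y \<longleftrightarrow> vindex x < vindex y"
instance
  by standard (auto simp: less_eq_vname_def less_vname_def intro: vindex_inj)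
end

lemma UNIV_vname: "UNIV = {Vq1, Vp1, Vq2, Vp2, Vt, V\<alpha>1, V\<alpha>2, V\<alpha>3, V\<alpha>4, V\<alpha>5, V\<eta>}"
  using vname.exhaust by blast

instance vname :: finite
  by standard (simp add: UNIV_vname)

type_synonym mpoly = "(vname \<Rightarrow>\<^sub>0 nat) \<Rightarrow>\<^sub>0 complex"
type_synonym ratfun = "mpoly fract"

definition const :: "complex \<Rightarrow> ratfun" where
  "const c = Fract (Poly_Mapping.single 0 c) 1"

definition var :: "vname \<Rightarrow> ratfun" where
  "var x = Fract (Poly_Mapping.single (Poly_Mapping.single x 1) 1) 1"

definition q\<^sub>1 :: ratfun where "q\<^sub>1 = var Vq1"
definition p\<^sub>1 :: ratfun where "p\<^sub>1 = var Vp1"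
definition q\<^sub>2 :: ratfun where "q\<^sub>2 = var Vq2"
definition p\<^sub>2 :: ratfun where "p\<^sub>2 = var Vp2"
definition t :: ratfun where "t = var Vt"
definition \<alpha>\<^sub>1 :: ratfun where "\<alpha>\<^sub>1 = var V\<alpha>1"
definition \<alpha>\<^sub>2 :: ratfun where "\<alpha>\<^sub>2 = var V\<alpha>2"
definition \<alpha>\<^sub>3 :: ratfun where "\<alpha>\<^sub>3 = var V\<alpha>3"
definition \<alpha>\<^sub>4 :: ratfun where "\<alpha>\<^sub>4 = var V\<alpha>4"
definition \<alpha>\<^sub>5 :: ratfun where "\<alpha>\<^sub>5 = var V\<alpha>5"
definition \<eta> :: ratfun where "\<eta> = var V\<eta>"
definition \<alpha>\<^sub>0 :: ratfun where "\<alpha>\<^sub>0 = 1 - (\<alpha>\<^sub>1 + \<alpha>\<^sub>2 + \<alpha>\<^sub>3 + \<alpha>\<^sub>4 + \<alpha>\<^sub>5)"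

lemma sum_\<alpha>: "\<alpha>\<^sub>0 + \<alpha>\<^sub>1 + \<alpha>\<^sub>2 + \<alpha>\<^sub>3 + \<alpha>\<^sub>4 + \<alpha>\<^sub>5 = 1"
  by (simp add: \<alpha>\<^sub>0_def)

abbreviation params :: "ratfun list" where
  "params \<equiv> [\<alpha>\<^sub>0, \<alpha>\<^sub>1, \<alpha>\<^sub>2, \<alpha>\<^sub>3, \<alpha>\<^sub>4, \<alpha>\<^sub>5, \<eta>]"


section \<open>Substitution automorphisms\<close>

definition is_automorphism :: "(ratfun \<Rightarrow> ratfun) \<Rightarrow> bool" where
  "is_automorphism \<phi> \<longleftrightarrow>
     bij \<phi> \<and> (\<forall>f g. \<phi> (f + g) = \<phi> f + \<phi> g) \<and> (\<forall>f g. \<phi> (f * g) = \<phi> f * \<phi> g) \<and>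
     (\<forall>c. \<phi> (const c) = const c)"

definition sends_tuple_to :: "(ratfun \<Rightarrow> ratfun) \<Rightarrow> ratfun list \<Rightarrow> bool" where
  "sends_tuple_to \<phi> ys \<longleftrightarrow> map \<phi> ([q\<^sub>1, p\<^sub>1, q\<^sub>2, p\<^sub>2, t] @ params) = ys"

text \<open>
  That the definite description is proper for each of the four transformations is established
  at the end of this theory.
\<close>

definition substitution :: "ratfun list \<Rightarrow> ratfun \<Rightarrow> ratfun" where
  "substitution ys = (THE \<phi>. is_automorphism \<phi> \<and> sends_tuple_to \<phi> ys)"

abbreviation tuple\<^sub>1 :: "ratfun list" where
  "tuple\<^sub>1 \<equiv> [q\<^sub>1 + \<alpha>\<^sub>1 / p\<^sub>1, p\<^sub>1, q\<^sub>2, p\<^sub>2, t,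
     \<alpha>\<^sub>0 + \<alpha>\<^sub>1, - \<alpha>\<^sub>1, \<alpha>\<^sub>2 + \<alpha>\<^sub>1, \<alpha>\<^sub>3, \<alpha>\<^sub>4, \<alpha>\<^sub>5, \<eta> - \<alpha>\<^sub>1]"

abbreviation tuple\<^sub>2 :: "ratfun list" where
  "tuple\<^sub>2 \<equiv> [q\<^sub>1, p\<^sub>1 - \<alpha>\<^sub>2 / (q\<^sub>1 - t), q\<^sub>2, p\<^sub>2, t,
     \<alpha>\<^sub>0, \<alpha>\<^sub>1 + \<alpha>\<^sub>2, - \<alpha>\<^sub>2, \<alpha>\<^sub>3 + \<alpha>\<^sub>2, \<alpha>\<^sub>4, \<alpha>\<^sub>5, \<eta> + \<alpha>\<^sub>2]"

abbreviation tuple\<^sub>5 :: "ratfun list" where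
  "tuple\<^sub>5 \<equiv> [q\<^sub>1, p\<^sub>1, q\<^sub>2 + \<alpha>\<^sub>5 / p\<^sub>2, p\<^sub>2, t,
     \<alpha>\<^sub>0 + \<alpha>\<^sub>5, \<alpha>\<^sub>1, \<alpha>\<^sub>2, \<alpha>\<^sub>3, \<alpha>\<^sub>4 + \<alpha>\<^sub>5, - \<alpha>\<^sub>5, \<eta> - \<alpha>\<^sub>5]"

abbreviation tuple\<^sub>1\<^sub>0 :: "ratfun list" where
  "tuple\<^sub>1\<^sub>0 \<equiv> [t / q\<^sub>2, - ((p\<^sub>2 * q\<^sub>2 + p\<^sub>1 * q\<^sub>1 + \<eta>) * q\<^sub>2 / t), q\<^sub>1 / q\<^sub>2, p\<^sub>1 * q\<^sub>2, t,
     \<alpha>\<^sub>2, \<alpha>\<^sub>3, \<alpha>\<^sub>4, \<alpha>\<^sub>5, \<alpha>\<^sub>0, \<alpha>\<^sub>1, \<eta>]"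

definition s\<^sub>1 :: "ratfun \<Rightarrow> ratfun" where "s\<^sub>1 = substitution tuple\<^sub>1"
definition s\<^sub>2 :: "ratfun \<Rightarrow> ratfun" where "s\<^sub>2 = substitution tuple\<^sub>2"
definition s\<^sub>5 :: "ratfun \<Rightarrow> ratfun" where "s\<^sub>5 = substitution tuple\<^sub>5"
definition s\<^sub>1\<^sub>0 :: "ratfun \<Rightarrow> ratfun" where "s\<^sub>1\<^sub>0 = substitution tuple\<^sub>1\<^sub>0"

definition T\<^sub>1 :: "ratfun \<Rightarrow> ratfun" where "T\<^sub>1 = (s\<^sub>2 \<circ> s\<^sub>1\<^sub>0 \<circ> s\<^sub>1\<^sub>0 \<circ> s\<^sub>1) ^^ 4"
definition T\<^sub>2 :: "ratfun \<Rightarrow> ratfun" where "T\<^sub>2 = s\<^sub>1 \<circ> T\<^sub>1 \<circ> s\<^sub>1"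
definition T\<^sub>3 :: "ratfun \<Rightarrow> ratfun" where "T\<^sub>3 = s\<^sub>5 \<circ> T\<^sub>1 \<circ> s\<^sub>5"


section \<open>Existence and uniqueness of the substitution automorphisms\<close>

subsection \<open>Evaluation of polynomials\<close>

lemma single_eq_0: "Poly_Mapping.single k v = 0 \<longleftrightarrow> v = (0 :: 'b :: zero)"
  by (metis lookup_single_eq lookup_zero single_zero)

lemma const_0: "const 0 = 0" and const_1: "const 1 = 1"
  by (simp_all add: const_def Zero_fract_def One_fract_def flip: single_one)

lemma const_add: "const (a + b) = const a + const b"
  and const_mult: "const (a * b) = const a * const b"
  and const_minus: "const (- a) = - const a"
  by (simp_all add: const_def single_add mult_single single_uminus)

definition monom_ev :: "(vname \<Rightarrow> ratfun) \<Rightarrow> (vname \<Rightarrow>\<^sub>0 nat) \<Rightarrow> ratfun" where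
  "monom_ev \<sigma> m = (\<Prod>x\<in>UNIV. \<sigma> x ^ Poly_Mapping.lookup m x)"

definition ev :: "(vname \<Rightarrow> ratfun) \<Rightarrow> mpoly \<Rightarrow> ratfun" where
  "ev \<sigma> p = (\<Sum>m\<in>Poly_Mapping.keys p. const (Poly_Mapping.lookup p m) * monom_ev \<sigma> m)"

lemma monom_ev_add: "monom_ev \<sigma> (m + n) = monom_ev \<sigma> m * monom_ev \<sigma> n"
  by (simp add: monom_ev_def lookup_add power_add prod.distrib)

lemma monom_ev_0: "monom_ev \<sigma> 0 = 1"
  by (simp add: monom_ev_def)

lemma monom_ev_single: "monom_ev \<sigma> (Poly_Mapping.single x 1) = \<sigma> x"
proof -
  have "monom_ev \<sigma> (Poly_Mapping.single x 1) = (\<Prod>y\<in>UNIV. if y = x then \<sigma> y else 1)"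
    unfolding monom_ev_def by (rule prod.cong) (auto simp: lookup_single when_def)
  then show ?thesis by simp
qed

lemma ev_superset:
  assumes "finite S" "Poly_Mapping.keys p \<subseteq> S"
  shows "ev \<sigma> p = (\<Sum>m\<in>S. const (Poly_Mapping.lookup p m) * monom_ev \<sigma> m)"
  unfolding ev_def
  by (rule sum.mono_neutral_left) (use assms in \<open>auto simp: in_keys_iff const_0\<close>)

lemma ev_add: "ev \<sigma> (p + q) = ev \<sigma> p + ev \<sigma> q"
proof -
  let ?S = "Poly_Mapping.keys p \<union> Poly_Mapping.keys q"
  have "ev \<sigma> r = (\<Sum>m\<in>?S. const (Poly_Mapping.lookup r m) * monom_ev \<sigma> m)"
    if "Poly_Mapping.keys r \<subseteq> ?S" for r
    by (rule ev_superset) (use that in auto)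
  moreover have "Poly_Mapping.keys (p + q) \<subseteq> ?S" by (rule keys_add)
  ultimately show ?thesis
    by (simp add: lookup_add const_add distrib_right sum.distrib)
qed

lemma ev_single: "ev \<sigma> (Poly_Mapping.single m c) = const c * monom_ev \<sigma> m"
  by (subst ev_superset[of "{m}"]) auto

lemma ev_const: "ev \<sigma> (Poly_Mapping.single 0 c) = const c"
  by (simp add: ev_single monom_ev_0)

lemma ev_var: "ev \<sigma> (Poly_Mapping.single (Poly_Mapping.single x 1) 1) = \<sigma> x"
  by (simp only: ev_single monom_ev_single const_1 mult_1)

lemma ev_0: "ev \<sigma> 0 = 0"
  by (simp add: ev_def)

lemma ev_1: "ev \<sigma> 1 = 1"
  using ev_const[of \<sigma> 1] by (simp add: const_1)

lemma mpoly_induct: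
  assumes single: "\<And>m c. P (Poly_Mapping.single m c)"
    and add: "\<And>p q. P p \<Longrightarrow> P q \<Longrightarrow> P (p + q)"
  shows "P (p :: mpoly)"
proof -
  let ?f = "\<lambda>m. Poly_Mapping.single m (Poly_Mapping.lookup p m)"
  have "P (sum ?f S)" if "finite S" for S
    using that
  proof (induction S)
    case empty
    then show ?case using single[of 0 0] by simp
  next
    case (insert x S)
    then show ?case by (simp add: add single)
  qed
  moreover have "sum ?f (Poly_Mapping.keys p) = p"
    by (rule poly_mapping_eqI) (auto simp: lookup_sum lookup_single when_def in_keys_iff)
  ultimately show ?thesis by (metis finite_keys)
qed

lemma ev_mult: "ev \<sigma> (p * q) = ev \<sigma> p * ev \<sigma> q"
proof (induction p rule: mpoly_induct)
  case (1 m c)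
  show ?case
    by (induction q rule: mpoly_induct)
      (simp_all add: mult_single ev_single const_mult monom_ev_add distrib_left ev_add algebra_simps)
next
  case (2 p q')
  then show ?case by (simp add: distrib_right ev_add)
qed

lemma ev_minus: "ev \<sigma> (- p) = - ev \<sigma> p"
  by (metis add.right_inverse ev_add ev_0 minus_unique)


subsection \<open>Values of rational functions\<close>

text \<open>
  \<open>has_value \<tau> f g\<close>: substituting \<open>\<tau>\<close> into \<open>f\<close> is meaningful and yields \<open>g\<close>.
\<close>

definition has_value :: "(vname \<Rightarrow> ratfun) \<Rightarrow> ratfun \<Rightarrow> ratfun \<Rightarrow> bool" where
  "has_value \<tau> f g \<longleftrightarrow>
     (\<exists>a b. b \<noteq> 0 \<and> ev \<tau> b \<noteq> 0 \<and> f = Fract a b \<and> g = ev \<tau> a / ev \<tau> b)"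

lemma has_valueI:
  "b \<noteq> 0 \<Longrightarrow> ev \<tau> b \<noteq> 0 \<Longrightarrow> f = Fract a b \<Longrightarrow> g = ev \<tau> a / ev \<tau> b \<Longrightarrow> has_value \<tau> f g"
  unfolding has_value_def by blast

lemma has_value_const: "has_value \<tau> (const c) (const c)"
  by (rule has_valueI[of 1 _ _ "Poly_Mapping.single 0 c"]) (simp_all add: ev_1 ev_const const_def)

lemma has_value_1: "has_value \<tau> 1 1"
  using has_value_const[of \<tau> 1] by (simp add: const_1)

lemma has_value_var: "has_value \<tau> (var x) (\<tau> x)"
  by (rule has_valueI[of 1 _ _ "Poly_Mapping.single (Poly_Mapping.single x 1) 1"])
    (simp_all add: ev_1 ev_var[simplified] var_def)

lemma has_value_add:
  assumes "has_value \<tau> f g" "has_value \<tau> f' g'"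
  shows "has_value \<tau> (f + f') (g + g')"
proof -
  obtain a b a' b' where "b \<noteq> 0" "ev \<tau> b \<noteq> 0" "f = Fract a b" "g = ev \<tau> a / ev \<tau> b"
    "b' \<noteq> 0" "ev \<tau> b' \<noteq> 0" "f' = Fract a' b'" "g' = ev \<tau> a' / ev \<tau> b'"
    using assms unfolding has_value_def by blast
  then show ?thesis
    by (intro has_valueI[of "b * b'" _ _ "a * b' + a' * b"])
      (simp_all add: ev_mult ev_add add_frac_eq)
qed

lemma has_value_mult:
  assumes "has_value \<tau> f g" "has_value \<tau> f' g'"
  shows "has_value \<tau> (f * f') (g * g')"
proof -
  obtain a b a' b' where "b \<noteq> 0" "ev \<tau> b \<noteq> 0" "f = Fract a b" "g = ev \<tau> a / ev \<tau> b"
    "b' \<noteq> 0" "ev \<tau> b' \<noteq> 0" "f' = Fract a' b'" "g' = ev \<tau> a' / ev \<tau> b'"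
    using assms unfolding has_value_def by blast
  then show ?thesis
    by (intro has_valueI[of "b * b'" _ _ "a * a'"]) (simp_all add: ev_mult)
qed

lemma has_value_minus: "has_value \<tau> f g \<Longrightarrow> has_value \<tau> (- f) (- g)"
  using has_value_mult[OF has_value_const[of \<tau> "-1"]] by (simp add: const_minus const_1)

lemma has_value_diff:
  "has_value \<tau> f g \<Longrightarrow> has_value \<tau> f' g' \<Longrightarrow> has_value \<tau> (f - f') (g - g')"
  using has_value_add[OF _ has_value_minus] by fastforce

lemma has_value_divide:
  assumes "has_value \<tau> f g" "has_value \<tau> f' g'" "g' \<noteq> 0"
  shows "has_value \<tau> (f / f') (g / g')"
proof -
  obtain a b a' b' where *: "b \<noteq> 0" "ev \<tau> b \<noteq> 0" "f = Fract a b" "g = ev \<tau> a / ev \<tau> b"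
    "b' \<noteq> 0" "ev \<tau> b' \<noteq> 0" "f' = Fract a' b'" "g' = ev \<tau> a' / ev \<tau> b'"
    using assms(1,2) unfolding has_value_def by blast
  with assms(3) have "ev \<tau> a' \<noteq> 0" by auto
  moreover from this have "a' \<noteq> 0" using ev_0 by metis
  ultimately show ?thesis using *
    by (intro has_valueI[of "b * a'" _ _ "a * b'"]) (simp_all add: ev_mult)
qed

lemma Fract_eq_0: "b \<noteq> 0 \<Longrightarrow> Fract a b = 0 \<longleftrightarrow> a = 0"
  by (simp add: Zero_fract_def eq_fract)

lemma has_value_0: "has_value \<tau> 0 g \<Longrightarrow> g = 0"
  unfolding has_value_def by (metis Fract_eq_0 div_0 ev_0)

lemma has_value_power: "has_value \<tau> f g \<Longrightarrow> has_value \<tau> (f ^ n) (g ^ n)"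
  by (induction n) (simp_all add: has_value_1 has_value_mult)

lemma has_value_prod:
  "finite S \<Longrightarrow> (\<And>x. x \<in> S \<Longrightarrow> has_value \<tau> (f x) (g x)) \<Longrightarrow> has_value \<tau> (prod f S) (prod g S)"
  by (induction S rule: finite_induct) (simp_all add: has_value_1 has_value_mult)

lemma has_value_ev:
  assumes "\<And>x. has_value \<tau> (\<sigma> x) (\<rho> x)"
  shows "has_value \<tau> (ev \<sigma> p) (ev \<rho> p)"
  by (induction p rule: mpoly_induct)
    (auto simp: ev_single ev_add monom_ev_def
      intro!: has_value_add has_value_mult has_value_const has_value_prod has_value_power assms)

lemma monom_ev_var: "monom_ev var m = Fract (Poly_Mapping.single m 1) 1"
proof -
  let ?X = "\<lambda>x. Poly_Mapping.single (Poly_Mapping.single x (1::nat)) (1::complex)"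
  have pow: "var x ^ n = Fract (Poly_Mapping.single (Poly_Mapping.single x n) 1) 1" for x n
    by (induction n)
      (simp_all add: One_fract_def var_def mult_single flip: single_add)
  have "(\<Prod>x\<in>S. var x ^ Poly_Mapping.lookup m x) =
      Fract (Poly_Mapping.single (\<Sum>x\<in>S. Poly_Mapping.single x (Poly_Mapping.lookup m x)) 1) 1"
    for S
    by (induction S rule: infinite_finite_induct) (simp_all add: One_fract_def pow mult_single)
  moreover have "(\<Sum>x\<in>UNIV. Poly_Mapping.single x (Poly_Mapping.lookup m x)) = m"
    by (rule poly_mapping_eqI) (simp add: lookup_sum lookup_single when_def)
  ultimately show ?thesis by (simp add: monom_ev_def)
qed

lemma ev_var_id: "ev var p = Fract p 1"
  by (induction p rule: mpoly_induct)
    (simp_all add: ev_single monom_ev_var const_def mult_single ev_add)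

lemma has_value_unique:
  assumes "has_value \<tau> f g" "has_value \<tau> f g'"
  shows "g = g'"
  using has_value_0[of \<tau> "g - g'"] has_value_diff[OF assms] has_value_0 by fastforce

lemma Fract_divide: "b \<noteq> 0 \<Longrightarrow> Fract a b = Fract a 1 / Fract b 1"
  by simp

text \<open>
  The hypothesis says that \<open>\<tau>\<close> is a left inverse of \<open>\<sigma>\<close>; in particular no denominator vanishes.
\<close>

lemma ev_eq_0_imp:
  assumes "\<And>x. has_value \<tau> (\<sigma> x) (var x)" "ev \<sigma> p = 0"
  shows "p = 0"
proof -
  have "has_value \<tau> 0 (Fract p 1)"
    using has_value_ev[of \<tau> \<sigma> var p, OF assms(1)] assms(2) by (simp add: ev_var_id)
  then show ?thesis using has_value_0[of \<tau> "Fract p 1"] by (simp add: Fract_eq_0)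
qed

lemma has_value_total:
  assumes "\<And>x. has_value \<tau> (\<sigma> x) (var x)"
  shows "\<exists>g. has_value \<sigma> f g \<and> has_value \<tau> g f"
proof (cases f)
  case (Fract a b)
  have b: "ev \<sigma> b \<noteq> 0" using ev_eq_0_imp[OF assms] Fract by blast
  have "has_value \<tau> (ev \<sigma> p) (Fract p 1)" for p
    using has_value_ev[of \<tau> \<sigma> var p, OF assms] by (simp add: ev_var_id)
  then have "has_value \<tau> (ev \<sigma> a / ev \<sigma> b) (Fract a 1 / Fract b 1)"
    by (intro has_value_divide) (use Fract in \<open>simp_all add: Fract_eq_0\<close>)
  moreover have "has_value \<sigma> f (ev \<sigma> a / ev \<sigma> b)"
    by (rule has_valueI) (use Fract b in auto)
  ultimately show ?thesis using Fract by (auto simp: Fract_divide[symmetric])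
qed

lemma automorphism_exists:
  assumes inv: "\<And>x. has_value \<tau> (\<sigma> x) (var x)" "\<And>x. has_value \<sigma> (\<tau> x) (var x)"
  shows "\<exists>\<phi>. is_automorphism \<phi> \<and> (\<forall>x. \<phi> (var x) = \<sigma> x)"
proof -
  define \<phi> where "\<phi> f = (THE g. has_value \<sigma> f g)" for f
  define \<psi> where "\<psi> f = (THE g. has_value \<tau> f g)" for f
  have \<phi>: "has_value \<sigma> f g \<Longrightarrow> \<phi> f = g" for f g
    unfolding \<phi>_def by (rule the_equality) (auto intro: has_value_unique)
  have \<psi>: "has_value \<tau> f g \<Longrightarrow> \<psi> f = g" for f g
    unfolding \<psi>_def by (rule the_equality) (auto intro: has_value_unique)
  have \<phi>': "has_value \<sigma> f (\<phi> f)" for f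
    using has_value_total[OF inv(1), of f] \<phi> by auto
  have "\<psi> (\<phi> f) = f" for f
    using has_value_total[OF inv(1), of f] \<phi> \<psi> by auto
  moreover have "\<phi> (\<psi> f) = f" for f
    using has_value_total[OF inv(2), of f] \<phi> \<psi> by auto
  ultimately have "bij \<phi>" by (metis bij_iff)
  then have "is_automorphism \<phi>"
    by (auto simp: is_automorphism_def intro!: \<phi> has_value_add has_value_mult has_value_const \<phi>')
  then show ?thesis using \<phi>[OF has_value_var] by blast
qed

lemma automorphism_simps:
  assumes "is_automorphism \<phi>"
  shows "\<phi> (f + g) = \<phi> f + \<phi> g" "\<phi> (f * g) = \<phi> f * \<phi> g" "\<phi> (const c) = const c"
    "\<phi> 0 = 0" "\<phi> 1 = 1" "\<phi> (- f) = - \<phi> f" "\<phi> (f - g) = \<phi> f - \<phi> g" "\<phi> (f / g) = \<phi> f / \<phi> g"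
proof -
  show add: "\<phi> (f + g) = \<phi> f + \<phi> g" and mult: "\<phi> (f * g) = \<phi> f * \<phi> g"
    and cnst: "\<phi> (const c) = const c" for f g c
    using assms by (auto simp: is_automorphism_def)
  show zero: "\<phi> 0 = 0" and one: "\<phi> 1 = 1"
    using cnst[of 0] cnst[of 1] by (simp_all add: const_0 const_1)
  show minus: "\<phi> (- f) = - \<phi> f" for f
    using add[of f "- f"] zero by (simp add: minus_unique)
  show "\<phi> (f - g) = \<phi> f - \<phi> g"
    using add[of f "- g"] minus by simp
  show "\<phi> (f / g) = \<phi> f / \<phi> g"
  proof (cases "g = 0")
    case False
    moreover have "inj \<phi>" using assms by (auto simp: is_automorphism_def bij_def)
    ultimately have "\<phi> g \<noteq> 0" using zero by (metis injD)
    moreover have "\<phi> (f / g) * \<phi> g = \<phi> f" using False by (simp flip: mult)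
    ultimately show ?thesis by (simp add: eq_divide_eq)
  qed (simp add: zero)
qed

lemma automorphism_ev:
  assumes "is_automorphism \<phi>"
  shows "\<phi> (Fract p 1) = ev (\<lambda>x. \<phi> (var x)) p"
proof -
  have pow: "\<phi> (f ^ n) = \<phi> f ^ n" for f n
    by (induction n) (simp_all add: automorphism_simps[OF assms])
  have prod: "\<phi> (prod f S) = (\<Prod>x\<in>S. \<phi> (f x))" if "finite S" for f :: "vname \<Rightarrow> ratfun" and S
    using that by (induction S) (simp_all add: automorphism_simps[OF assms])
  have "\<phi> (ev var p) = ev (\<lambda>x. \<phi> (var x)) p"
    by (induction p rule: mpoly_induct)
      (simp_all add: ev_single ev_add monom_ev_def automorphism_simps[OF assms] pow prod)
  then show ?thesis by (simp add: ev_var_id)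
qed

lemma automorphism_eqI:
  assumes "is_automorphism \<phi>" "is_automorphism \<psi>" "\<And>x. \<phi> (var x) = \<psi> (var x)"
  shows "\<phi> = \<psi>"
proof
  fix f :: ratfun
  show "\<phi> f = \<psi> f"
  proof (cases f)
    case (Fract a b)
    then have "f = Fract a 1 / Fract b 1" by simp
    then show ?thesis
      using assms by (simp only: automorphism_simps(8) automorphism_ev)
  qed
qed


subsection \<open>The four transformations\<close>

lemmas generator_defs =
  q\<^sub>1_def p\<^sub>1_def q\<^sub>2_def p\<^sub>2_def t_def \<alpha>\<^sub>1_def \<alpha>\<^sub>2_def \<alpha>\<^sub>3_def \<alpha>\<^sub>4_def \<alpha>\<^sub>5_def \<eta>_def

lemma var_nonzero: "var x \<noteq> 0"
  by (simp add: var_def Fract_eq_0 single_eq_0)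

lemma var_inj: "var x = var y \<Longrightarrow> x = y"
proof -
  assume "var x = var y"
  then have "Poly_Mapping.single (Poly_Mapping.single x (1::nat)) (1::complex)
      = Poly_Mapping.single (Poly_Mapping.single y 1) 1"
    by (simp add: var_def eq_fract)
  then have "Poly_Mapping.keys (Poly_Mapping.single (Poly_Mapping.single x (1::nat)) (1::complex))
      = Poly_Mapping.keys (Poly_Mapping.single (Poly_Mapping.single y (1::nat)) (1::complex))"
    by simp
  then have "Poly_Mapping.keys (Poly_Mapping.single x (1::nat))
      = Poly_Mapping.keys (Poly_Mapping.single y (1::nat))"
    by simp
  then show "x = y" by simp
qed

lemma generators_nonzero: "p\<^sub>1 \<noteq> 0" "p\<^sub>2 \<noteq> 0" "q\<^sub>1 \<noteq> 0" "q\<^sub>2 \<noteq> 0" "t \<noteq> 0" "q\<^sub>1 - t \<noteq> 0"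
  using var_inj[of Vq1 Vt] by (auto simp: generator_defs var_nonzero)

primrec assign :: "ratfun list \<Rightarrow> vname \<Rightarrow> ratfun" where
  "assign ys Vq1 = ys ! 0" | "assign ys Vp1 = ys ! 1" | "assign ys Vq2 = ys ! 2"
| "assign ys Vp2 = ys ! 3" | "assign ys Vt = ys ! 4" | "assign ys V\<alpha>1 = ys ! 6"
| "assign ys V\<alpha>2 = ys ! 7" | "assign ys V\<alpha>3 = ys ! 8" | "assign ys V\<alpha>4 = ys ! 9"
| "assign ys V\<alpha>5 = ys ! 10" | "assign ys V\<eta> = ys ! 11"

lemma sends_tuple_to_iff:
  assumes aut: "is_automorphism \<phi>"
    and len: "length ys = 12"
    and \<alpha>: "ys ! 5 = 1 - (ys ! 6 + ys ! 7 + ys ! 8 + ys ! 9 + ys ! 10)"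
  shows "sends_tuple_to \<phi> ys \<longleftrightarrow> (\<forall>x. \<phi> (var x) = assign ys x)"
proof -
  obtain y0 y1 y2 y3 y4 y5 y6 y7 y8 y9 y10 y11
    where ys: "ys = [y0, y1, y2, y3, y4, y5, y6, y7, y8, y9, y10, y11]"
    using len by (auto simp: numeral_eq_Suc length_Suc_conv)
  have y5: "y5 = 1 - (y6 + y7 + y8 + y9 + y10)"
    using \<alpha> by (simp add: ys)
  have "(\<forall>x. \<phi> (var x) = assign ys x) \<longleftrightarrow> (\<forall>x\<in>UNIV. \<phi> (var x) = assign ys x)"
    by simp
  also have "\<dots> \<longleftrightarrow> \<phi> q\<^sub>1 = y0 \<and> \<phi> p\<^sub>1 = y1 \<and> \<phi> q\<^sub>2 = y2 \<and> \<phi> p\<^sub>2 = y3 \<and> \<phi> t = y4 \<and>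
      \<phi> \<alpha>\<^sub>1 = y6 \<and> \<phi> \<alpha>\<^sub>2 = y7 \<and> \<phi> \<alpha>\<^sub>3 = y8 \<and> \<phi> \<alpha>\<^sub>4 = y9 \<and> \<phi> \<alpha>\<^sub>5 = y10 \<and> \<phi> \<eta> = y11"
    unfolding UNIV_vname by (simp add: ys generator_defs)
  also have "\<dots> \<longleftrightarrow> sends_tuple_to \<phi> ys"
    unfolding sends_tuple_to_def ys y5 \<alpha>\<^sub>0_def by (auto simp: automorphism_simps[OF aut])
  finally show ?thesis ..
qed

lemma ex1_automorphism:
  assumes inv: "\<And>x. has_value (assign zs) (assign ys x) (var x)"
      "\<And>x. has_value (assign ys) (assign zs x) (var x)"
    and len: "length ys = 12"
    and \<alpha>: "ys ! 5 = 1 - (ys ! 6 + ys ! 7 + ys ! 8 + ys ! 9 + ys ! 10)"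
  shows "\<exists>!\<phi>. is_automorphism \<phi> \<and> sends_tuple_to \<phi> ys"
proof (rule ex_ex1I)
  show "\<exists>\<phi>. is_automorphism \<phi> \<and> sends_tuple_to \<phi> ys"
    using automorphism_exists[OF inv] sends_tuple_to_iff[OF _ len \<alpha>] by blast
  show "\<phi> = \<psi>" if "is_automorphism \<phi> \<and> sends_tuple_to \<phi> ys"
    "is_automorphism \<psi> \<and> sends_tuple_to \<psi> ys" for \<phi> \<psi>
    using that by (intro automorphism_eqI) (auto simp: sends_tuple_to_iff[OF _ len \<alpha>])
qed

lemma has_value_eq: "has_value \<tau> f g \<Longrightarrow> g = h \<Longrightarrow> has_value \<tau> f h"
  by simp

lemma has_value_generators:
  "has_value (assign ys) q\<^sub>1 (ys ! 0)"
  "has_value (assign ys) p\<^sub>1 (ys ! 1)"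
  "has_value (assign ys) q\<^sub>2 (ys ! 2)"
  "has_value (assign ys) p\<^sub>2 (ys ! 3)"
  "has_value (assign ys) t (ys ! 4)"
  "has_value (assign ys) \<alpha>\<^sub>1 (ys ! 6)"
  "has_value (assign ys) \<alpha>\<^sub>2 (ys ! 7)"
  "has_value (assign ys) \<alpha>\<^sub>3 (ys ! 8)"
  "has_value (assign ys) \<alpha>\<^sub>4 (ys ! 9)"
  "has_value (assign ys) \<alpha>\<^sub>5 (ys ! 10)"
  "has_value (assign ys) \<eta> (ys ! 11)"
  unfolding generator_defs
  by (rule has_value_var[of "assign ys", THEN has_value_eq], simp)+

lemma has_value_\<alpha>\<^sub>0:
  "has_value (assign ys) \<alpha>\<^sub>0 (1 - (ys ! 6 + ys ! 7 + ys ! 8 + ys ! 9 + ys ! 10))"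
  unfolding \<alpha>\<^sub>0_def
  by (intro has_value_diff has_value_add has_value_1 has_value_generators)

lemmas has_value_intros = has_value_add has_value_mult has_value_diff has_value_minus
  has_value_divide has_value_1 has_value_generators has_value_\<alpha>\<^sub>0

lemma ex1_s\<^sub>1: "\<exists>!\<phi>. is_automorphism \<phi> \<and> sends_tuple_to \<phi> tuple\<^sub>1"
proof (rule ex1_automorphism)
  show "has_value (assign tuple\<^sub>1) (assign tuple\<^sub>1 x) (var x)" for x
    by (cases x; simp flip: generator_defs; rule has_value_eq, (rule has_value_intros)+;
        simp add: generators_nonzero)
  then show "has_value (assign tuple\<^sub>1) (assign tuple\<^sub>1 x) (var x)" for x .
qed (simp_all add: \<alpha>\<^sub>0_def)

lemma ex1_s\<^sub>2: "\<exists>!\<phi>. is_automorphism \<phi> \<and> sends_tuple_to \<phi> tuple\<^sub>2"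
proof (rule ex1_automorphism)
  show "has_value (assign tuple\<^sub>2) (assign tuple\<^sub>2 x) (var x)" for x
    by (cases x; simp flip: generator_defs; rule has_value_eq, (rule has_value_intros)+;
        simp add: generators_nonzero[simplified])
  then show "has_value (assign tuple\<^sub>2) (assign tuple\<^sub>2 x) (var x)" for x .
qed (simp_all add: \<alpha>\<^sub>0_def)

lemma ex1_s\<^sub>5: "\<exists>!\<phi>. is_automorphism \<phi> \<and> sends_tuple_to \<phi> tuple\<^sub>5"
proof (rule ex1_automorphism)
  show "has_value (assign tuple\<^sub>5) (assign tuple\<^sub>5 x) (var x)" for x
    by (cases x; simp flip: generator_defs; rule has_value_eq, (rule has_value_intros)+;
        simp add: generators_nonzero)
  then show "has_value (assign tuple\<^sub>5) (assign tuple\<^sub>5 x) (var x)" for x .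
qed (simp_all add: \<alpha>\<^sub>0_def)

abbreviation tuple\<^sub>1\<^sub>0_inverse :: "ratfun list" where
  "tuple\<^sub>1\<^sub>0_inverse \<equiv> [t * q\<^sub>2 / q\<^sub>1, p\<^sub>2 * q\<^sub>1 / t, t / q\<^sub>1,
     - ((p\<^sub>1 * q\<^sub>1 + p\<^sub>2 * q\<^sub>2 + \<eta>) * q\<^sub>1 / t), t, \<alpha>\<^sub>4, \<alpha>\<^sub>5, \<alpha>\<^sub>0, \<alpha>\<^sub>1, \<alpha>\<^sub>2, \<alpha>\<^sub>3, \<eta>]"

lemma ex1_s\<^sub>1\<^sub>0: "\<exists>!\<phi>. is_automorphism \<phi> \<and> sends_tuple_to \<phi> tuple\<^sub>1\<^sub>0"
proof (rule ex1_automorphism)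
  show "has_value (assign tuple\<^sub>1\<^sub>0_inverse) (assign tuple\<^sub>1\<^sub>0 x) (var x)" for x
    by (cases x; simp flip: generator_defs; rule has_value_eq, (rule has_value_intros)+;
        simp add: generators_nonzero field_simps \<alpha>\<^sub>0_def)
  show "has_value (assign tuple\<^sub>1\<^sub>0) (assign tuple\<^sub>1\<^sub>0_inverse x) (var x)" for x
    by (cases x; simp flip: generator_defs; rule has_value_eq, (rule has_value_intros)+;
        simp add: generators_nonzero field_simps \<alpha>\<^sub>0_def)
qed (simp_all add: \<alpha>\<^sub>0_def)

lemma
  shows s\<^sub>1: "is_automorphism s\<^sub>1" "sends_tuple_to s\<^sub>1 tuple\<^sub>1"
    and s\<^sub>2: "is_automorphism s\<^sub>2" "sends_tuple_to s\<^sub>2 tuple\<^sub>2"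
    and s\<^sub>5: "is_automorphism s\<^sub>5" "sends_tuple_to s\<^sub>5 tuple\<^sub>5"
    and s\<^sub>1\<^sub>0: "is_automorphism s\<^sub>1\<^sub>0" "sends_tuple_to s\<^sub>1\<^sub>0 tuple\<^sub>1\<^sub>0"
  using theI'[OF ex1_s\<^sub>1] theI'[OF ex1_s\<^sub>2] theI'[OF ex1_s\<^sub>5] theI'[OF ex1_s\<^sub>1\<^sub>0]
  unfolding s\<^sub>1_def s\<^sub>2_def s\<^sub>5_def s\<^sub>1\<^sub>0_def substitution_def by blast+

end

theory Submission
  imports Defs
begin

text \<open>Each generator maps the linear span of the parameters to itself, so the claim is linear
  algebra and the images of the q's, p's and t never enter. In \<open>T\<^sub>1_params\<close> the
  shift first appears as a multiple of the sum of all \<alpha>'s, which equals 1. The other two are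
  conjugates: if \<open>T\<^sub>1\<close> adds a constant c(f) to each linear form f in the
  parameters, then \<open>T\<^sub>2\<close> adds c(\<open>s\<^sub>1\<close> f), since
  \<open>s\<^sub>1\<close> is an involution on parameters and fixes constants; likewise
  \<open>T\<^sub>3\<close> with \<open>s\<^sub>5\<close>.\<close>

lemmas generator_automorphisms = s\<^sub>1(1) s\<^sub>2(1) s\<^sub>5(1) s\<^sub>1\<^sub>0(1)

text \<open>Additivity and preservation of 1 suffice, because parameters are never multiplied or
  divided.\<close>

lemmas automorphism_hom_simps =
  generator_automorphisms[THEN automorphism_simps(1)]
  generator_automorphisms[THEN automorphism_simps(5)]
  generator_automorphisms[THEN automorphism_simps(6)]
  generator_automorphisms[THEN automorphism_simps(7)]

lemma s\<^sub>1_params: "map s\<^sub>1 params = [\<alpha>\<^sub>0 + \<alpha>\<^sub>1, - \<alpha>\<^sub>1, \<alpha>\<^sub>2 + \<alpha>\<^sub>1, \<alpha>\<^sub>3, \<alpha>\<^sub>4, \<alpha>\<^sub>5, \<eta> - \<alpha>\<^sub>1]"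
  using s\<^sub>1(2) by (simp add: sends_tuple_to_def)

lemma s\<^sub>2_params: "map s\<^sub>2 params = [\<alpha>\<^sub>0, \<alpha>\<^sub>1 + \<alpha>\<^sub>2, - \<alpha>\<^sub>2, \<alpha>\<^sub>3 + \<alpha>\<^sub>2, \<alpha>\<^sub>4, \<alpha>\<^sub>5, \<eta> + \<alpha>\<^sub>2]"
  using s\<^sub>2(2) by (simp add: sends_tuple_to_def)

lemma s\<^sub>5_params: "map s\<^sub>5 params = [\<alpha>\<^sub>0 + \<alpha>\<^sub>5, \<alpha>\<^sub>1, \<alpha>\<^sub>2, \<alpha>\<^sub>3, \<alpha>\<^sub>4 + \<alpha>\<^sub>5, - \<alpha>\<^sub>5, \<eta> - \<alpha>\<^sub>5]"
  using s\<^sub>5(2) by (simp add: sends_tuple_to_def)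

lemma s\<^sub>1\<^sub>0_params: "map s\<^sub>1\<^sub>0 params = [\<alpha>\<^sub>2, \<alpha>\<^sub>3, \<alpha>\<^sub>4, \<alpha>\<^sub>5, \<alpha>\<^sub>0, \<alpha>\<^sub>1, \<eta>]"
  using s\<^sub>1\<^sub>0(2) by (simp add: sends_tuple_to_def)

lemmas params_simps =
  s\<^sub>1_params[simplified] s\<^sub>2_params[simplified] s\<^sub>5_params[simplified] s\<^sub>1\<^sub>0_params[simplified]

lemma T\<^sub>1_params: "map T\<^sub>1 params = [\<alpha>\<^sub>0, \<alpha>\<^sub>1 - 1, \<alpha>\<^sub>2 + 1, \<alpha>\<^sub>3, \<alpha>\<^sub>4 - 1, \<alpha>\<^sub>5 + 1, \<eta>]"
proof -
  \<comment> \<open>Half of the fourth power: \<open>T\<^sub>1\<close> is v applied twice. Since v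
    swaps \<alpha>0 and \<alpha>3, its change \<alpha>0 - \<alpha>3 of \<eta> cancels the second
    time.\<close>
  define v where "v = (s\<^sub>2 \<circ> s\<^sub>1\<^sub>0 \<circ> s\<^sub>1\<^sub>0 \<circ> s\<^sub>1) ^^ 2"
  have v_params: "map v params =
     [\<alpha>\<^sub>3, - \<alpha>\<^sub>2 - \<alpha>\<^sub>3, \<alpha>\<^sub>2 + \<alpha>\<^sub>3 + \<alpha>\<^sub>4 + \<alpha>\<^sub>5, \<alpha>\<^sub>0, - \<alpha>\<^sub>0 - \<alpha>\<^sub>5, \<alpha>\<^sub>0 + \<alpha>\<^sub>1 + \<alpha>\<^sub>2 + \<alpha>\<^sub>5,
      \<eta> + \<alpha>\<^sub>0 - \<alpha>\<^sub>3]"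
    by (simp add: v_def eval_nat_numeral automorphism_hom_simps params_simps)
  have v_hom: "v (f + g) = v f + v g" "v (- f) = - v f" "v (f - g) = v f - v g" for f g
    by (simp_all add: v_def eval_nat_numeral automorphism_hom_simps)
  have T\<^sub>1_eq: "T\<^sub>1 f = v (v f)" for f
    by (simp add: T\<^sub>1_def v_def eval_nat_numeral)
  show ?thesis
    \<comment> \<open>Reversing \<open>sum_\<alpha>\<close> expands each 1 into the sum of the
      \<alpha>'s, so both sides become homogeneous linear forms.\<close>
    using v_params by (simp add: T\<^sub>1_eq v_hom flip: sum_\<alpha>)
qed

text \<open>Extends \<open>T\<^sub>1_params\<close> to the linear forms produced by
  \<open>s\<^sub>1\<close> and \<open>s\<^sub>5\<close>, so the fourth power need not be expanded
  again.\<close>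

lemma T\<^sub>1_hom: "T\<^sub>1 (f + g) = T\<^sub>1 f + T\<^sub>1 g" "T\<^sub>1 (- f) = - T\<^sub>1 f" "T\<^sub>1 (f - g) = T\<^sub>1 f - T\<^sub>1 g"
  by (simp_all add: T\<^sub>1_def eval_nat_numeral automorphism_hom_simps)

theorem proposition1p1:
  shows "map T\<^sub>1 params = map2 (+) params [0, -1, 1, 0, -1, 1, 0]
    \<and> map T\<^sub>2 params = map2 (+) params [-1, 1, 0, 0, -1, 1, 1]
    \<and> map T\<^sub>3 params = map2 (+) params [1, -1, 1, 0, 0, -1, -1]"
  using T\<^sub>1_params
  by (simp add: T\<^sub>2_def T\<^sub>3_def T\<^sub>1_hom automorphism_hom_simps params_simps)

end
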